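(* Let $K$ be a valued field with valuation ring $R$ and residue field $k$. Suppose that the value group has a unique minimal strictly positive element and let $\pi\in R$ have this minimal strictly positive valuation. Let $\mathcal{L}$ be an expansion of $\mathcal{L}_{\rm v}$ (interpreted on $K$) and let $\mathrm{ac}:K\to k$ be an angular component map. Put $R^{(1)}=\{x\in R\mid \mathrm{ac}(x)=1\}$. If $R^{(1)}$ is $\mathcal{L}$-definable, then $$K_0(K,\mathcal{L})=0,\qquad K^2\cong_{\mathcal{L}}K^2\setminus\{(0,0)\},\quad\text{and}\quad R^2\cong_{\mathcal{L}}R^2\setminus\{(0,0)\}.$$
   Context: Valued field: a field $K$ with a map $v:K\to G\cup\{\infty\}$, $G$ an ordered abelian group (the value group), with $v(x)=\infty$ iff $x=0$, $v(xy)=v(x)+v(y)$, $v(x+y)\ge\min\{v(x),v(y)\}$. The valuation ring is $R=\{x\in K\mid v(x)\ge 0\}$, $M$ is its maximal ideal, $k=R/M$ the residue field. An angular component map is a group homomorphism $\mathrm{ac}:K^\times\to k^\times$, extended by $\mathrm{ac}(0)=0$, with $\mathrm{ac}(x)=x\bmod M$ whenever $v(x)=0$. $\mathcal{L}_{\rm ring}=(+,-,\cdot,0,1)$ is the language of rings; $\mathcal{L}_{\rm v}=(\mathcal{L}_{\rm ring},R)$ is the language of rings with an extra unary relation symbol interpreted as the valuation ring $R$. Definable always means definable with parameters; a function is definable if its graph is. Grothendieck ring: for $\mathcal{L}$-definable sets $X\subset K^m$, $Y\subset K^n$ ($m,n>0$), write $X\cong_{\mathcal{L}}Y$ if there is an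 $\mathcal{L}$-definable bijection $X\to Y$. $K_0(K,\mathcal{L})$ is the abelian group generated by symbols $[A]$, for $A$ an $\mathcal{L}$-definable set, with the relations $[A]=[A']$ if $A\cong_{\mathcal{L}}A'$, and $[A]=[B]+[C]$ if $A$ is the disjoint union of the definable sets $B$ and $C$; it is a ring with multiplication induced by $[A\times B]=[A][B]$ (the unit is the class of a point). *)

theory Defs
  imports "HOL-Algebra.Algebra" "HOL-Algebra.Algebraic_Closure_Type"
begin

datatype 'g with_inf = Val 'g | Infty

instantiation with_inf :: (linorder) linorder
begin

fun less_eq_with_inf :: "'a with_inf \<Rightarrow> 'a with_inf \<Rightarrow> bool" where
  "x \<le> Infty \<longleftrightarrow> True"
| "Infty \<le> Val b \<longleftrightarrow> False"
| "Val a \<le> Val b \<longleftrightarrow> a \<le> b"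

definition less_with_inf :: "'a with_inf \<Rightarrow> 'a with_inf \<Rightarrow> bool" where
  "x < y \<longleftrightarrow> x \<le> y \<and> \<not> y \<le> (x :: 'a with_inf)"

instance
proof
  fix x y z :: "'a with_inf"
  show "x < y \<longleftrightarrow> x \<le> y \<and> \<not> y \<le> x" by (rule less_with_inf_def)
  show "x \<le> x" by (cases x) auto
  show "x \<le> y \<Longrightarrow> y \<le> z \<Longrightarrow> x \<le> z" by (cases x; cases y; cases z) auto
  show "x \<le> y \<Longrightarrow> y \<le> x \<Longrightarrow> x = y" by (cases x; cases y) auto
  show "x \<le> y \<or> y \<le> x" by (cases x; cases y) auto
qed

end

instantiation with_inf :: (comm_monoid_add) comm_monoid_add
begin

definition zero_with_inf :: "'a with_inf" where
  "0 = Val 0"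

fun plus_with_inf :: "'a with_inf \<Rightarrow> 'a with_inf \<Rightarrow> 'a with_inf" where
  "Val a + Val b = Val (a + b)"
| "Val a + Infty = Infty"
| "Infty + y = Infty"

instance
proof
  fix x y z :: "'a with_inf"
  show "x + y + z = x + (y + z)" by (cases x; cases y; cases z) (auto simp: add.assoc)
  show "x + y = y + x" by (cases x; cases y) (auto simp: add.commute)
  show "0 + x = x" by (cases x) (auto simp: zero_with_inf_def)
qed

end

locale valued_field =
  fixes v :: "'a::field \<Rightarrow> 'g::linordered_ab_group_add with_inf"
  assumes v_eq_Infty_iff: "v x = Infty \<longleftrightarrow> x = 0"
    and v_mult: "v (x * y) = v x + v y"
    and v_add: "min (v x) (v y) \<le> v (x + y)"

text \<open>
  The type of values may be larger than \<open>v(K\<^sup>\<times>)\<close>; the value group is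
  the subgroup \<open>v(K\<^sup>\<times>)\<close>.
\<close>
definition value_group :: "('a::field \<Rightarrow> 'g with_inf) \<Rightarrow> 'g set" where
  "value_group v = {\<gamma>. \<exists>x. x \<noteq> 0 \<and> v x = Val \<gamma>}"

definition minimal_positive :: "'g::linordered_ab_group_add set \<Rightarrow> 'g \<Rightarrow> bool" where
  "minimal_positive G \<gamma> \<longleftrightarrow> \<gamma> \<in> G \<and> 0 < \<gamma> \<and> \<not> (\<exists>\<delta>\<in>G. 0 < \<delta> \<and> \<delta> < \<gamma>)"

definition valuation_ring ::
    "('a::field \<Rightarrow> 'g::linordered_ab_group_add with_inf) \<Rightarrow> 'a ring" where
  "valuation_ring v = ring_of_type_algebra\<lparr>carrier := {x. 0 \<le> v x}\<rparr>"

definition max_ideal ::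
    "('a::field \<Rightarrow> 'g::linordered_ab_group_add with_inf) \<Rightarrow> 'a set" where
  "max_ideal v = {x. 0 < v x}"

definition residue_field ::
    "('a::field \<Rightarrow> 'g::linordered_ab_group_add with_inf) \<Rightarrow> 'a set ring" where
  "residue_field v = valuation_ring v Quot max_ideal v"

definition angular_component ::
    "('a::field \<Rightarrow> 'g::linordered_ab_group_add with_inf) \<Rightarrow> ('a \<Rightarrow> 'a set) \<Rightarrow> bool" where
  "angular_component v ac \<longleftrightarrow>
     ac \<in> hom (mult_of ring_of_type_algebra) (mult_of (residue_field v)) \<and>
     ac 0 = \<zero>\<^bsub>residue_field v\<^esub> \<and>
     (\<forall>x. v x = 0 \<longrightarrow> ac x = max_ideal v +>\<^bsub>valuation_ring v\<^esub> x)"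

definition R1 ::
    "('a::field \<Rightarrow> 'g::linordered_ab_group_add with_inf) \<Rightarrow> ('a \<Rightarrow> 'a set) \<Rightarrow> 'a set" where
  "R1 v ac = {x \<in> carrier (valuation_ring v). ac x = \<one>\<^bsub>residue_field v\<^esub>}"

text \<open>
  The symbols of a language are the elements of the sets \<open>funs\<close> and
  \<open>rels\<close>, constants being function symbols of arity 0. Values of arities
  and interpretations at other symbols, or at tuples of the wrong length, are irrelevant.
  The universe of a structure is the whole type \<open>'a\<close>.
\<close>
record ('f, 'r) language =
  funs :: "'f set"
  rels :: "'r set"
  farity :: "'f \<Rightarrow> nat"
  rarity :: "'r \<Rightarrow> nat"

record ('f, 'r, 'a) fo_struct =
  finterp :: "'f \<Rightarrow> 'a list \<Rightarrow> 'a"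
  rinterp :: "'r \<Rightarrow> 'a list \<Rightarrow> bool"

datatype 'f tm = Var nat | App 'f "'f tm list"

datatype ('f, 'r) fm =
    Eq "'f tm" "'f tm"
  | Rel 'r "'f tm list"
  | Neg "('f, 'r) fm"
  | Conj "('f, 'r) fm" "('f, 'r) fm"
  | Ex nat "('f, 'r) fm"

fun tm_of :: "('f, 'r) language \<Rightarrow> 'f tm \<Rightarrow> bool" where
  "tm_of L (Var i) \<longleftrightarrow> True"
| "tm_of L (App f ts) \<longleftrightarrow>
     f \<in> funs L \<and> length ts = farity L f \<and> (\<forall>t\<in>set ts. tm_of L t)"

primrec fm_of :: "('f, 'r) language \<Rightarrow> ('f, 'r) fm \<Rightarrow> bool" where
  "fm_of L (Eq s t) \<longleftrightarrow> tm_of L s \<and> tm_of L t"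
| "fm_of L (Rel r ts) \<longleftrightarrow>
     r \<in> rels L \<and> length ts = rarity L r \<and> (\<forall>t\<in>set ts. tm_of L t)"
| "fm_of L (Neg \<phi>) \<longleftrightarrow> fm_of L \<phi>"
| "fm_of L (Conj \<phi> \<psi>) \<longleftrightarrow> fm_of L \<phi> \<and> fm_of L \<psi>"
| "fm_of L (Ex i \<phi>) \<longleftrightarrow> fm_of L \<phi>"

fun tm_val :: "('f, 'r, 'a) fo_struct \<Rightarrow> (nat \<Rightarrow> 'a) \<Rightarrow> 'f tm \<Rightarrow> 'a" where
  "tm_val S e (Var i) = e i"
| "tm_val S e (App f ts) = finterp S f (map (tm_val S e) ts)"

primrec sat :: "('f, 'r, 'a) fo_struct \<Rightarrow> (nat \<Rightarrow> 'a) \<Rightarrow> ('f, 'r) fm \<Rightarrow> bool" where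
  "sat S e (Eq s t) \<longleftrightarrow> tm_val S e s = tm_val S e t"
| "sat S e (Rel r ts) \<longleftrightarrow> rinterp S r (map (tm_val S e) ts)"
| "sat S e (Neg \<phi>) \<longleftrightarrow> \<not> sat S e \<phi>"
| "sat S e (Conj \<phi> \<psi>) \<longleftrightarrow> sat S e \<phi> \<and> sat S e \<psi>"
| "sat S e (Ex i \<phi>) \<longleftrightarrow> (\<exists>a. sat S (e(i := a)) \<phi>)"

text \<open>
  Points of \<open>K\<^sup>n\<close> are lists of length \<open>n\<close>, and concatenation identifies
  \<open>K\<^sup>m \<times> K\<^sup>n\<close> with the power \<open>K\<close> to the \<open>m + n\<close>.
\<close>
definition tuples :: "nat \<Rightarrow> 'a set \<Rightarrow> 'a list set" where
  "tuples n A = {xs. length xs = n \<and> set xs \<subseteq> A}"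

text \<open>
  Definability with parameters: the variables below \<open>n\<close> are the coordinates,
  and the assignment \<open>e\<close> supplies the parameters, of which a formula only
  uses finitely many.
\<close>
definition definable ::
    "('f, 'r) language \<Rightarrow> ('f, 'r, 'a) fo_struct \<Rightarrow> nat \<Rightarrow> 'a list set \<Rightarrow> bool" where
  "definable L S n A \<longleftrightarrow>
     (\<exists>\<phi> e. fm_of L \<phi> \<and>
        A = {xs \<in> tuples n UNIV. sat S (\<lambda>i. if i < n then xs ! i else e i) \<phi>})"

definition definable_sets ::
    "('f, 'r) language \<Rightarrow> ('f, 'r, 'a) fo_struct \<Rightarrow> 'a list set set" where
  "definable_sets L S = {A. \<exists>n>0. definable L S n A}"

definition definably_isomorphic ::
    "('f, 'r) language \<Rightarrow> ('f, 'r, 'a) fo_struct \<Rightarrow> 'a list set \<Rightarrow> 'a list set \<Rightarrow> bool" where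
  "definably_isomorphic L S A B \<longleftrightarrow>
     (\<exists>m>0. \<exists>n>0. definable L S m A \<and> definable L S n B \<and>
        (\<exists>f. bij_betw f A B \<and> definable L S (m + n) {xs @ f xs | xs. xs \<in> A}))"

definition is_expansion ::
    "('f, 'r) language \<Rightarrow> ('f, 'r, 'a) fo_struct \<Rightarrow>
     ('f, 'r) language \<Rightarrow> ('f, 'r, 'a) fo_struct \<Rightarrow> bool" where
  "is_expansion L' S' L S \<longleftrightarrow>
     funs L \<subseteq> funs L' \<and> rels L \<subseteq> rels L' \<and>
     (\<forall>f\<in>funs L. farity L' f = farity L f) \<and>
     (\<forall>r\<in>rels L. rarity L' r = rarity L r) \<and>
     (\<forall>f\<in>funs L. \<forall>xs. length xs = farity L f \<longrightarrow> finterp S' f xs = finterp S f xs) \<and>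
     (\<forall>r\<in>rels L. \<forall>xs. length xs = rarity L r \<longrightarrow> rinterp S' r xs = rinterp S r xs)"

text \<open>
  The symbols \<open>ExtraF\<close> and \<open>ExtraR\<close> do not belong to the language
  \<open>Lv\<close>; they are a supply of names for its expansions.
\<close>
datatype 'f vf_fun = Plus | Minus | Times | Zero | One | ExtraF 'f

datatype 'r vf_rel = InR | ExtraR 'r

definition Lv :: "('f vf_fun, 'r vf_rel) language" where
  "Lv = \<lparr>funs = {Plus, Minus, Times, Zero, One}, rels = {InR},
         farity = (\<lambda>f. if f \<in> {Plus, Minus, Times} then 2 else 0),
         rarity = (\<lambda>r. 1)\<rparr>"

primrec Lv_fun :: "'f vf_fun \<Rightarrow> 'a::field list \<Rightarrow> 'a" where
  "Lv_fun Plus xs = xs ! 0 + xs ! 1"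
| "Lv_fun Minus xs = xs ! 0 - xs ! 1"
| "Lv_fun Times xs = xs ! 0 * xs ! 1"
| "Lv_fun Zero xs = 0"
| "Lv_fun One xs = 1"
| "Lv_fun (ExtraF f) xs = undefined"

primrec Lv_rel ::
    "('a::field \<Rightarrow> 'g::linordered_ab_group_add with_inf) \<Rightarrow>
     'r vf_rel \<Rightarrow> 'a list \<Rightarrow> bool" where
  "Lv_rel v InR xs \<longleftrightarrow> xs ! 0 \<in> carrier (valuation_ring v)"
| "Lv_rel v (ExtraR r) xs \<longleftrightarrow> undefined"

definition Lv_struct ::
    "('a::field \<Rightarrow> 'g::linordered_ab_group_add with_inf) \<Rightarrow>
     ('f vf_fun, 'r vf_rel, 'a) fo_struct" where
  "Lv_struct v = \<lparr>finterp = Lv_fun, rinterp = Lv_rel v\<rparr>"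

definition cartesian :: "'a list set \<Rightarrow> 'a list set \<Rightarrow> 'a list set" where
  "cartesian A B = {xs @ ys | xs ys. xs \<in> A \<and> ys \<in> B}"

text \<open>
  The free abelian group on the definable sets, with the bilinear multiplication
  extending the cartesian product, and with the point \<open>0 \<in> K\<close> in the place of
  the unit. This is not a ring in the sense of \<^const>\<open>ring\<close>: the point is neutral
  only up to definable bijection, that is, after passing to the quotient \<open>K0\<close>.
\<close>
definition definable_free ::
    "('f, 'r) language \<Rightarrow> ('f, 'r, 'a::zero) fo_struct \<Rightarrow> ('a list set \<Rightarrow>\<^sub>0 int) ring" where
  "definable_free L S =
     \<lparr>carrier = {c. Poly_Mapping.keys c \<subseteq> definable_sets L S},
      monoid.mult = (\<lambda>p q. frag_extend (\<lambda>A. frag_extend (\<lambda>B. frag_of (cartesian A B)) q) p),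
      one = frag_of {[0]}, ring.zero = 0, ring.add = (+)\<rparr>"

definition K0_relations ::
    "('f, 'r) language \<Rightarrow> ('f, 'r, 'a) fo_struct \<Rightarrow> ('a list set \<Rightarrow>\<^sub>0 int) set" where
  "K0_relations L S =
     {frag_of A - frag_of A' | A A'. definably_isomorphic L S A A'} \<union>
     {frag_of A - (frag_of B + frag_of C) | A B C.
        A \<in> definable_sets L S \<and> B \<in> definable_sets L S \<and> C \<in> definable_sets L S \<and>
        A = B \<union> C \<and> B \<inter> C = {}}"

definition K0 ::
    "('f, 'r) language \<Rightarrow> ('f, 'r, 'a::zero) fo_struct \<Rightarrow> ('a list set \<Rightarrow>\<^sub>0 int) set ring" where
  "K0 L S = definable_free L S Quot
     generate (add_monoid (definable_free L S)) (K0_relations L S)"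

end

theory Submission
  imports Defs
begin

text \<open>
  Write \<open>P\<close> for \<open>R\<^sup>(\<^sup>1\<^sup>)\<close>. Dividing the given uniformizer by a unit with the same angular component
  yields an element \<open>p\<close> of minimal positive valuation with \<open>ac p = 1\<close>. The elements of \<open>P\<close> of
  positive valuation are then exactly those of \<open>p P\<close>, and those of valuation 0 form
  \<open>1 + M = 1 + p R\<close>, so that \<open>P\<close> is the disjoint union of \<open>p P\<close> and \<open>1 + p R\<close>: up to definable
  bijection \<open>P\<close> absorbs a copy of \<open>R\<close>, in symbols \<open>P \<cong> P + R\<close>.

  This is used twice. First, the line \<open>{0} \<times> R\<close> is absorbed into \<open>P \<times> {0}\<close>, which gives a definable
  bijection of \<open>R\<^sup>2\<close> onto \<open>(R - {0}) \<times> R\<close> (\<open>bij_absorb\<close>). Secondly,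
  \<open>P \<times> R \<cong> P \<times> R + R \<times> R\<close>, so \<open>(R - {0}) \<times> R\<close> is isomorphic to the disjoint union of itself and
  \<open>R\<^sup>2\<close>, that is, to two copies of itself. One copy is mapped onto
  \<open>{(x, y) \<in> R\<^sup>2. x \<noteq> 0, v(x) \<le> v(y)}\<close> by \<open>(a, b) \<mapsto> (a, a b)\<close>, and the other onto
  \<open>{(x, y) \<in> R\<^sup>2. v(x) > v(y)}\<close> by \<open>(c, d) \<mapsto> (p c d, c)\<close>; these two sets
  partition \<open>R\<^sup>2 - {(0, 0)}\<close> (\<open>bij_spread\<close>). The composite is a definable bijection of
  \<open>R\<^sup>2\<close> onto \<open>R\<^sup>2 - {(0, 0)}\<close>, and the identity outside \<open>R\<^sup>2\<close> extends it to \<open>K\<^sup>2\<close>.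

  For a definable set \<open>A\<close>, the product of this bijection with the identity of \<open>A\<close> shows that
  \<open>[A \<times> K\<^sup>2] = [A \<times> (K\<^sup>2 - {(0, 0)})]\<close>, hence \<open>[A] = [A \<times> {(0, 0)}] = 0\<close>
  (\<open>K0_trivial\<close>).
\<close>

section \<open>Definable predicates and functions\<close>

fun rename_tm :: "(nat \<Rightarrow> nat) \<Rightarrow> 'f tm \<Rightarrow> 'f tm" where
  "rename_tm \<sigma> (Var i) = Var (\<sigma> i)"
| "rename_tm \<sigma> (App f ts) = App f (map (rename_tm \<sigma>) ts)"

text \<open>Bound variables are renamed as well; this is harmless for injective renamings.\<close>
primrec rename_fm :: "(nat \<Rightarrow> nat) \<Rightarrow> ('f, 'r) fm \<Rightarrow> ('f, 'r) fm" where
  "rename_fm \<sigma> (Eq s t) = Eq (rename_tm \<sigma> s) (rename_tm \<sigma> t)"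
| "rename_fm \<sigma> (Rel r ts) = Rel r (map (rename_tm \<sigma>) ts)"
| "rename_fm \<sigma> (Neg \<phi>) = Neg (rename_fm \<sigma> \<phi>)"
| "rename_fm \<sigma> (Conj \<phi> \<psi>) = Conj (rename_fm \<sigma> \<phi>) (rename_fm \<sigma> \<psi>)"
| "rename_fm \<sigma> (Ex i \<phi>) = Ex (\<sigma> i) (rename_fm \<sigma> \<phi>)"

lemma tm_of_rename: "tm_of L (rename_tm \<sigma> t) = tm_of L t"
  by (induction t rule: rename_tm.induct) auto

lemma fm_of_rename: "fm_of L (rename_fm \<sigma> \<phi>) = fm_of L \<phi>"
  by (induction \<phi>) (auto simp: tm_of_rename)

lemma tm_val_rename: "tm_val S e (rename_tm \<sigma> t) = tm_val S (\<lambda>i. e (\<sigma> i)) t"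
  by (induction t) (simp_all add: comp_def cong: map_cong)

lemma sat_rename:
  assumes "inj \<sigma>"
  shows "sat S e (rename_fm \<sigma> \<phi>) = sat S (\<lambda>i. e (\<sigma> i)) \<phi>"
proof (induction \<phi> arbitrary: e)
  case (Rel r ts)
  show ?case
    by (simp add: tm_val_rename comp_def)
next
  case (Ex i \<phi>)
  have "(\<lambda>j. (e(\<sigma> i := a)) (\<sigma> j)) = (\<lambda>j. e (\<sigma> j))(i := a)" for a
    using assms by (auto simp: fun_eq_iff inj_eq)
  then show ?case
    by (simp add: Ex)
qed (simp_all add: tm_val_rename)

text \<open>
  The assignment with the values of \<open>x\<close> at the even variables and those of \<open>p\<close> at the odd ones.
\<close>
definition interleave :: "(nat \<Rightarrow> 'a) \<Rightarrow> (nat \<Rightarrow> 'a) \<Rightarrow> nat \<Rightarrow> 'a" where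
  "interleave x p i = (if even i then x (i div 2) else p (i div 2))"

locale fo_definability =
  fixes L :: "('f, 'r) language" and S :: "('f, 'r, 'a) fo_struct"
begin

text \<open>
  A predicate on assignments is definable with parameters if it is given by a formula whose
  even variables stand for the assignment and whose odd variables stand for the parameters.
  Keeping infinitely many variables free for parameters makes it possible to combine two
  formulas with different parameters.
\<close>
definition defpred :: "((nat \<Rightarrow> 'a) \<Rightarrow> bool) \<Rightarrow> bool" where
  "defpred P \<longleftrightarrow> (\<exists>\<phi> p. fm_of L \<phi> \<and> (\<forall>x. P x \<longleftrightarrow> sat S (interleave x p) \<phi>))"

text \<open>A function on assignments is definable if its graph is, with the value in variable 0.\<close>
definition deffun :: "((nat \<Rightarrow> 'a) \<Rightarrow> 'a) \<Rightarrow> bool" where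
  "deffun t \<longleftrightarrow> defpred (\<lambda>x. x 0 = t (\<lambda>i. x (Suc i)))"

lemma defpredI:
  assumes "fm_of L \<phi>" "inj \<sigma>" "\<And>x. P x \<longleftrightarrow> sat S (\<lambda>i. interleave x p (\<sigma> i)) \<phi>"
  shows "defpred P"
  unfolding defpred_def using assms
  by (intro exI[of _ "rename_fm \<sigma> \<phi>"] exI[of _ p]) (simp add: sat_rename fm_of_rename)

lemma defpred_neg: "defpred P \<Longrightarrow> defpred (\<lambda>x. \<not> P x)"
  unfolding defpred_def by (metis fm_of.simps(3) sat.simps(3))

lemma defpred_conj:
  assumes "defpred P" "defpred Q"
  shows "defpred (\<lambda>x. P x \<and> Q x)"
proof -
  obtain \<phi> p where P: "fm_of L \<phi>" "\<And>x. P x \<longleftrightarrow> sat S (interleave x p) \<phi>"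
    using assms(1) unfolding defpred_def by blast
  obtain \<psi> q where Q: "fm_of L \<psi>" "\<And>x. Q x \<longleftrightarrow> sat S (interleave x q) \<psi>"
    using assms(2) unfolding defpred_def by blast
  \<comment> \<open>The parameters of the two formulas go to the two halves of the odd variables.\<close>
  define \<sigma> where "\<sigma> j = (if even j then j else 4 * (j div 2) + 1)" for j :: nat
  define \<tau> where "\<tau> j = (if even j then j else 4 * (j div 2) + 3)" for j :: nat
  have inj: "inj \<sigma>" "inj \<tau>"
    by (auto simp: inj_def \<sigma>_def \<tau>_def elim!: evenE oddE split: if_splits) presburger+
  have "(\<lambda>j. interleave x (interleave p q) (\<sigma> j)) = interleave x p" for x
  proof
    fix j :: nat
    show "interleave x (interleave p q) (\<sigma> j) = interleave x p j"
    proof (cases "even j")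
      case False
      then obtain k where "j = 2 * k + 1" by (rule oddE)
      moreover have "(4 * k + 1) div 2 = 2 * k" by presburger
      ultimately show ?thesis
        by (simp add: interleave_def \<sigma>_def)
    qed (simp add: interleave_def \<sigma>_def)
  qed
  moreover have "(\<lambda>j. interleave x (interleave p q) (\<tau> j)) = interleave x q" for x
  proof
    fix j :: nat
    have "(4 * (j div 2) + 3) div 2 = 2 * (j div 2) + 1" by presburger
    then show "interleave x (interleave p q) (\<tau> j) = interleave x q j"
      by (simp add: interleave_def \<tau>_def)
  qed
  ultimately show ?thesis
    unfolding defpred_def using inj P Q
    by (intro exI[of _ "Conj (rename_fm \<sigma> \<phi>) (rename_fm \<tau> \<psi>)"] exI[of _ "interleave p q"])
      (simp add: sat_rename fm_of_rename)
qed

lemma defpred_disj: "defpred P \<Longrightarrow> defpred Q \<Longrightarrow> defpred (\<lambda>x. P x \<or> Q x)"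
  using defpred_neg[OF defpred_conj[OF defpred_neg defpred_neg]] by simp

text \<open>
  Quantifiers in the style of de Bruijn: the bound variable is variable 0 and shifts the others.
\<close>
lemma defpred_ex:
  assumes "defpred (\<lambda>x. Q (x 0) (\<lambda>i. x (Suc i)))"
  shows "defpred (\<lambda>x. \<exists>a. Q a x)"
proof -
  obtain \<phi> p where P: "fm_of L \<phi>" "\<And>x. Q (x 0) (\<lambda>i. x (Suc i)) \<longleftrightarrow> sat S (interleave x p) \<phi>"
    using assms unfolding defpred_def by blast
  \<comment> \<open>The quantified variable moves to the parameter slot 1, and the parameters make room.\<close>
  define \<sigma> where "\<sigma> j = (if j = 0 then 1 else if even j then j - 2 else j + 2)" for j :: nat
  define q where "q i = p (i - 1)" for i
  have inj: "inj \<sigma>"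
    by (auto simp: inj_def \<sigma>_def elim!: evenE oddE split: if_splits) presburger+
  have "(\<lambda>j. ((interleave x q)(Suc 0 := a)) (\<sigma> j)) = interleave (case_nat a x) p" for x a
  proof
    fix j :: nat
    show "((interleave x q)(Suc 0 := a)) (\<sigma> j) = interleave (case_nat a x) p j"
    proof (cases "even j")
      case True
      then obtain k where "j = 2 * k" by blast
      then show ?thesis
        by (cases k) (auto simp: interleave_def \<sigma>_def)
    next
      case False
      then show ?thesis
        by (auto simp: interleave_def \<sigma>_def q_def)
    qed
  qed
  then have "(\<exists>a. Q a x) \<longleftrightarrow> sat S (interleave x q) (Ex 1 (rename_fm \<sigma> \<phi>))" for x
    using P(2)[of "case_nat _ x"] by (simp add: sat_rename inj)
  then show ?thesis
    unfolding defpred_def using P(1)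
    by (intro exI[of _ "Ex 1 (rename_fm \<sigma> \<phi>)"] exI[of _ q]) (simp add: fm_of_rename)
qed

lemma defpred_rename:
  assumes "defpred P" "inj \<sigma>"
  shows "defpred (\<lambda>x. P (\<lambda>i. x (\<sigma> i)))"
proof -
  obtain \<phi> p where P: "fm_of L \<phi>" "\<And>x. P x \<longleftrightarrow> sat S (interleave x p) \<phi>"
    using assms(1) unfolding defpred_def by blast
  define \<tau> where "\<tau> j = (if even j then 2 * \<sigma> (j div 2) else j)" for j :: nat
  have "inj \<tau>"
  proof (rule injI)
    fix i j assume "\<tau> i = \<tau> j"
    then show "i = j"
      using assms(2) unfolding \<tau>_def inj_def
      by (smt (verit, best) even_mult_iff even_two_times_div_two nat_mult_eq_cancel1
          dvd_triv_left zero_less_numeral)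
  qed
  moreover have "(\<lambda>j. interleave x p (\<tau> j)) = interleave (\<lambda>i. x (\<sigma> i)) p" for x
    by (auto simp: interleave_def \<tau>_def)
  ultimately show ?thesis
    using P by (intro defpredI[of \<phi> \<tau> _ p]) auto
qed

text \<open>
  A definable function may be substituted for a variable, since \<open>Q (t x) x\<close> says that some
  \<open>a = t x\<close> satisfies \<open>Q a x\<close>.
\<close>
lemma defpred_subst:
  assumes "deffun t" "defpred (\<lambda>x. Q (x 0) (\<lambda>i. x (Suc i)))"
  shows "defpred (\<lambda>x. Q (t x) x)"
  using defpred_ex[of "\<lambda>a x. a = t x \<and> Q a x"] defpred_conj[OF assms[unfolded deffun_def]]
  by simp

lemma deffun_shift:
  assumes "deffun t"
  shows "deffun (\<lambda>x. t (\<lambda>i. x (Suc i)))"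
proof -
  have "inj (case_nat 0 (\<lambda>i. Suc (Suc i)))"
    by (auto simp: inj_def split: nat.splits)
  from defpred_rename[OF assms[unfolded deffun_def] this] show ?thesis
    by (simp add: deffun_def)
qed

lemma defpred_comp1:
  assumes "defpred (\<lambda>x. Q (x 0))" "deffun t"
  shows "defpred (\<lambda>x. Q (t x))"
  using defpred_subst[OF assms(2), of "\<lambda>a x. Q a"] assms(1) by simp

lemma defpred_comp2:
  assumes Q: "defpred (\<lambda>x. Q (x 0) (x 1))" and t: "deffun t" and s: "deffun s"
  shows "defpred (\<lambda>x. Q (t x) (s x))"
proof -
  have "inj (\<lambda>i::nat. if i = 0 then 1 else if i = 1 then 0 else i)"
    by (auto simp: inj_def)
  from defpred_rename[OF Q this] have "defpred (\<lambda>x. Q (x (Suc 0)) (x 0))" by simp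
  then have "defpred (\<lambda>x. Q (x 0) (s (\<lambda>i. x (Suc i))))"
    by (rule defpred_subst[OF deffun_shift[OF s], of "\<lambda>b x. Q (x 0) b"])
  then show ?thesis
    by (rule defpred_subst[OF t, of "\<lambda>a x. Q a (s x)"])
qed

lemma deffun_comp2:
  assumes F: "deffun (\<lambda>x. F (x 0) (x 1))" and t: "deffun t" and s: "deffun s"
  shows "deffun (\<lambda>x. F (t x) (s x))"
proof -
  have rot: "inj (\<lambda>i::nat. if i = 0 then 2 else if i = 1 then 0 else if i = 2 then 1 else i)"
    by (auto simp: inj_def)
  have F0: "defpred (\<lambda>x. x 0 = F (x 1) (x 2))"
    using F by (simp add: deffun_def numeral_2_eq_2)
  \<comment> \<open>The variable 0 is the argument to be substituted next.\<close>
  have "defpred (\<lambda>x. x (Suc (Suc 0)) = F (x 0) (x (Suc 0)))"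
    using defpred_rename[OF F0 rot] by (simp add: numeral_2_eq_2)
  then have "defpred (\<lambda>x. x (Suc 0) = F (t (\<lambda>i. x (Suc (Suc i)))) (x 0))"
    using defpred_subst[OF deffun_shift[OF deffun_shift[OF t]],
        of "\<lambda>a x. x (Suc 0) = F a (x 0)"] by simp
  then show ?thesis
    unfolding deffun_def
    by (rule defpred_subst[OF deffun_shift[OF s], of "\<lambda>b x. x 0 = F (t (\<lambda>i. x (Suc i))) b"])
qed

lemma defpred_var_eq: "defpred (\<lambda>x. x i = x j)"
  by (rule defpredI[of "Eq (Var (2 * i)) (Var (2 * j))" id]) (auto simp: interleave_def)

lemma deffun_var: "deffun (\<lambda>x. x i)"
  unfolding deffun_def by (rule defpred_var_eq)

lemma deffun_const: "deffun (\<lambda>x. c)"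
  unfolding deffun_def
  by (rule defpredI[of "Eq (Var 0) (Var 1)" id _ "\<lambda>_. c"]) (auto simp: interleave_def)

lemma defpred_eq: "deffun t \<Longrightarrow> deffun s \<Longrightarrow> defpred (\<lambda>x. t x = s x)"
  by (rule defpred_comp2[of "(=)", OF defpred_var_eq])

lemma deffun_if:
  assumes "defpred C" "deffun t" "deffun s"
  shows "deffun (\<lambda>x. if C x then t x else s x)"
proof -
  have C: "defpred (\<lambda>x. C (\<lambda>i. x (Suc i)))"
    by (rule defpred_rename[OF assms(1)]) auto
  have "defpred (\<lambda>x. (C (\<lambda>i. x (Suc i)) \<and> x 0 = t (\<lambda>i. x (Suc i))) \<or>
      (\<not> C (\<lambda>i. x (Suc i)) \<and> x 0 = s (\<lambda>i. x (Suc i))))"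
    using assms(2,3) unfolding deffun_def
    by (intro defpred_disj defpred_conj defpred_neg C)
  then show ?thesis
    unfolding deffun_def by (rule back_subst[of defpred]) auto
qed

lemma defpred_all_less: "(\<And>i. i < n \<Longrightarrow> defpred (P i)) \<Longrightarrow> defpred (\<lambda>x. \<forall>i<n. P i x)" for n :: nat
proof (induction n)
  case 0
  show ?case using defpred_var_eq[of 0 0] by simp
next
  case (Suc n)
  then have "defpred (\<lambda>x. (\<forall>i<n. P i x) \<and> P n x)"
    by (intro defpred_conj) auto
  then show ?case by (simp add: All_less_Suc conj_commute)
qed

lemma defpred_definable:
  assumes "definable L S n A"
  shows "defpred (\<lambda>x. map x [0..<n] \<in> A)"
proof -
  obtain \<phi> e where \<phi>: "fm_of L \<phi>"
    and A: "A = {xs \<in> tuples n UNIV. sat S (\<lambda>i. if i < n then xs ! i else e i) \<phi>}"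
    using assms unfolding definable_def by blast
  define \<sigma> where "\<sigma> i = (if i < n then 2 * i else 2 * i + 1)" for i :: nat
  have inj: "inj \<sigma>"
    by (auto simp: inj_def \<sigma>_def elim!: evenE oddE split: if_splits)
  have "(\<lambda>i. if i < n then map x [0..<n] ! i else e i) = (\<lambda>i. interleave x e (\<sigma> i))" for x
    by (auto simp: interleave_def \<sigma>_def)
  then have "map x [0..<n] \<in> A \<longleftrightarrow> sat S (\<lambda>i. interleave x e (\<sigma> i)) \<phi>" for x
    by (simp add: A tuples_def)
  then show ?thesis
    using \<phi> inj by (rule defpredI[rotated 2])
qed

text \<open>
  The third assumption makes \<open>P\<close> depend on the variables below \<open>n\<close> only; the formula may still
  mention further even variables, to which arbitrary parameters are then assigned.
\<close>
lemma definableI: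
  assumes "defpred P" "A \<subseteq> tuples n UNIV"
    and "\<And>x. P x \<longleftrightarrow> map x [0..<n] \<in> A"
  shows "definable L S n A"
proof -
  obtain \<phi> p where P: "fm_of L \<phi>" "\<And>x. P x \<longleftrightarrow> sat S (interleave x p) \<phi>"
    using assms(1) unfolding defpred_def by blast
  define \<sigma> where "\<sigma> j = (if even j \<and> j < 2 * n then j div 2 else n + j)" for j :: nat
  define e where "e i = p ((i - n) div 2)" for i
  have inj: "inj \<sigma>"
    by (auto simp: inj_def \<sigma>_def elim!: evenE oddE split: if_splits)
  have "sat S (\<lambda>i. if i < n then xs ! i else e i) (rename_fm \<sigma> \<phi>) \<longleftrightarrow> xs \<in> A"
    if "length xs = n" for xs
  proof -
    define x where "x i = (if i < n then xs ! i else e (n + 2 * i))" for i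
    have "(\<lambda>j. if \<sigma> j < n then xs ! \<sigma> j else e (\<sigma> j)) = interleave x p"
      by (auto simp: \<sigma>_def interleave_def x_def e_def fun_eq_iff)
    moreover have "map x [0..<n] = xs"
      using that by (auto simp: x_def intro: nth_equalityI)
    ultimately show ?thesis
      using P(2)[of x] assms(3)[of x] by (simp add: sat_rename inj)
  qed
  then show ?thesis
    unfolding definable_def using P(1) assms(2)
    by (intro exI[of _ "rename_fm \<sigma> \<phi>"] exI[of _ e]) (auto simp: fm_of_rename tuples_def)
qed

end

section \<open>The plane and the punctured plane over the valuation ring\<close>

text \<open>
  The algebraic properties of the valuation ring \<open>R\<close>, of \<open>P = R\<^sup>(\<^sup>1\<^sup>)\<close> and of an element \<open>p\<close> of minimal
  positive valuation and angular component 1 that the bijections depend on. Since the maximal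
  ideal is \<open>p R\<close>, the condition \<open>x / p \<in> R\<close> expresses that \<open>x\<close> has positive valuation; thus
  the dichotomy compares \<open>v(x)\<close> with 0, and the last assumption says that the elements of \<open>P\<close> of
  valuation 0 are those of \<open>1 + p R\<close>.
\<close>
locale angular_ring =
  fixes R P :: "'a::field set" and p :: 'a
  assumes R_0: "0 \<in> R" and p_R: "p \<in> R" and p_nz: "p \<noteq> 0"
    and R_mult: "x \<in> R \<Longrightarrow> y \<in> R \<Longrightarrow> x * y \<in> R"
    and R_dichotomy: "x \<noteq> 0 \<Longrightarrow> x \<in> R \<longleftrightarrow> inverse (p * x) \<notin> R"
    and P_R: "P \<subseteq> R" and P_nz: "0 \<notin> P"
    and P_mult: "x \<in> P \<Longrightarrow> p * x \<in> P"
    and P_div: "x \<in> P \<Longrightarrow> x / p \<in> R \<Longrightarrow> x / p \<in> P"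
    and P_units: "x \<in> P \<and> x / p \<notin> R \<longleftrightarrow> (x - 1) / p \<in> R"
begin

text \<open>
  The bijection of \<open>R \<times> R\<close> onto \<open>(R - {0}) \<times> R\<close>: on the first axis, \<open>P\<close> shrinks to \<open>p P\<close> and
  leaves room in \<open>1 + p R\<close> for the second axis.
\<close>
definition absorb :: "'a \<Rightarrow> 'a \<Rightarrow> 'a \<times> 'a" where
  "absorb x y = (if x = 0 then (1 + p * y, 0) else if y = 0 \<and> x \<in> P then (p * x, 0) else (x, y))"

text \<open>
  The bijection of \<open>(R - {0}) \<times> R\<close> onto the punctured plane over \<open>R\<close>. The part \<open>(1 + p R) \<times> R\<close>
  is identified with \<open>R \<times> R\<close>, hence by \<open>absorb\<close> with \<open>(R - {0}) \<times> R\<close>, and fills the region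
  \<open>v(x) > v(y)\<close>. In the rest, \<open>p P\<close> is stretched to \<open>P\<close>, so that the rest also becomes all of
  \<open>(R - {0}) \<times> R\<close>; it fills the region \<open>v(x) \<le> v(y)\<close>.
\<close>
definition spread :: "'a \<Rightarrow> 'a \<Rightarrow> 'a \<times> 'a" where
  "spread a b =
     (if (a - 1) / p \<in> R then case absorb ((a - 1) / p) b of (c, d) \<Rightarrow> (p * c * d, c)
      else if a \<in> P then (a / p, a / p * b) else (a, a * b))"

text \<open>The inverses of \<open>absorb\<close> and \<open>spread\<close>.\<close>
definition unabsorb :: "'a \<Rightarrow> 'a \<Rightarrow> 'a \<times> 'a" where
  "unabsorb x y =
     (if y = 0 \<and> x \<in> P then if x / p \<in> R then (x / p, 0) else (0, (x - 1) / p) else (x, y))"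

definition unspread :: "'a \<Rightarrow> 'a \<Rightarrow> 'a \<times> 'a" where
  "unspread x y =
     (if x \<noteq> 0 \<and> y / x \<in> R then (if x \<in> P then p * x else x, y / x)
      else case unabsorb y (x / (p * y)) of (s, b) \<Rightarrow> (1 + p * s, b))"

lemma one_plus: "s \<in> R \<Longrightarrow> 1 + p * s \<in> P" "s \<in> R \<Longrightarrow> (1 + p * s) / p \<notin> R"
  using P_units[of "1 + p * s"] p_nz by auto

lemma P_mult_not_unit: "x \<in> P \<Longrightarrow> (p * x - 1) / p \<notin> R"
  using P_units[of "p * x"] P_R p_nz by auto

text \<open>Either \<open>v(x) \<le> v(y)\<close> or \<open>v(x) \<ge> v(p y)\<close>, and not both.\<close>
lemma divide_dichotomy:
  assumes "x \<noteq> 0" "y \<noteq> 0"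
  shows "y / x \<in> R \<longleftrightarrow> x / (p * y) \<notin> R"
  using R_dichotomy[of "y / x"] assms p_nz by (simp add: field_simps)

lemma unabsorb_absorb:
  assumes "x \<in> R" "y \<in> R" "absorb x y = (c, d)"
  shows "unabsorb c d = (x, y) \<and> c \<in> R \<and> c \<noteq> 0 \<and> d \<in> R"
proof -
  have "1 + p * y \<in> R" "1 + p * y \<noteq> 0"
    using one_plus[OF assms(2)] P_R P_nz by auto
  then show ?thesis
    using assms one_plus[OF assms(2)] P_mult[of x] P_nz P_R p_nz R_0 R_mult[OF p_R assms(1)]
    by (auto simp: absorb_def unabsorb_def split: if_splits)
qed

lemma absorb_unabsorb:
  assumes "x \<in> R" "x \<noteq> 0" "y \<in> R" "unabsorb x y = (c, d)"
  shows "absorb c d = (x, y) \<and> c \<in> R \<and> d \<in> R"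
  using assms P_div[of x] P_units[of x] p_nz R_0
  by (auto simp: absorb_def unabsorb_def split: if_splits)

lemma bij_absorb: "bij_betw (\<lambda>(x, y). absorb x y) (R \<times> R) ((R - {0}) \<times> R)"
proof -
  have fwd: "(case absorb x y of (c, d) \<Rightarrow> unabsorb c d) = (x, y) \<and> absorb x y \<in> (R - {0}) \<times> R"
    if "x \<in> R" "y \<in> R" for x y
    using unabsorb_absorb[OF that] by (cases "absorb x y") auto
  have bwd: "(case unabsorb x y of (c, d) \<Rightarrow> absorb c d) = (x, y) \<and> unabsorb x y \<in> R \<times> R"
    if "x \<in> R" "x \<noteq> 0" "y \<in> R" for x y
    using absorb_unabsorb[OF that] by (cases "unabsorb x y") auto
  show ?thesis
    by (rule bij_betw_byWitness[where f' = "\<lambda>(x, y). unabsorb x y"]) (use fwd bwd in \<open>auto simp: image_subset_iff\<close>)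
qed

lemma bij_spread: "bij_betw (\<lambda>(x, y). spread x y) ((R - {0}) \<times> R) (R \<times> R - {(0, 0)})"
proof (rule bij_betw_byWitness[where f' = "\<lambda>(x, y). unspread x y"])
  have swap: "y / x \<in> R \<longleftrightarrow> x / (p * y) \<notin> R" if "x \<noteq> 0" "y \<noteq> 0" for x y
    using divide_dichotomy that .
  have fwd: "unspread (fst (spread a b)) (snd (spread a b)) = (a, b) \<and>
     spread a b \<in> R \<times> R - {(0, 0)}" if "a \<in> R" "a \<noteq> 0" "b \<in> R" for a b
  proof (cases "(a - 1) / p \<in> R")
    case True
    obtain c d where cd: "absorb ((a - 1) / p) b = (c, d)" by fastforce
    then have *: "unabsorb c d = ((a - 1) / p, b)" "c \<in> R" "c \<noteq> 0" "d \<in> R"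
      using unabsorb_absorb[OF True that(3)] by auto
    have "p * c * d = 0 \<or> c / (p * c * d) \<notin> R"
      using swap[of "p * c * d" c] *(3,4) p_nz by auto
    moreover have "p * c * d / (p * c) = d"
      using * p_nz by simp
    ultimately show ?thesis
      using True cd * p_nz R_mult p_R by (auto simp: spread_def unspread_def)
  next
    case False
    then show ?thesis
      using that P_units[of a] P_div[of a] R_mult[of a b] R_mult[of "a / p" b] p_nz P_nz
      by (auto simp: spread_def unspread_def)
  qed
  have bwd: "spread (fst (unspread x y)) (snd (unspread x y)) = (x, y) \<and>
     unspread x y \<in> (R - {0}) \<times> R" if "x \<in> R" "y \<in> R" "x \<noteq> 0 \<or> y \<noteq> 0" for x y
  proof (cases "x \<noteq> 0 \<and> y / x \<in> R")
    case True
    then show ?thesis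
      using that P_units[of x] P_mult[of x] P_mult_not_unit[of x] P_R p_nz p_R R_mult
      by (auto simp: spread_def unspread_def)
  next
    case False
    then have y: "y \<noteq> 0"
      using that(3) R_0 by auto
    then have y': "x / (p * y) \<in> R"
      using False R_0 swap[of x y] by (cases "x = 0") auto
    obtain s b where sb: "unabsorb y (x / (p * y)) = (s, b)" by fastforce
    then have *: "absorb s b = (y, x / (p * y))" "s \<in> R" "b \<in> R"
      using absorb_unabsorb[OF that(2) y y'] by auto
    have "1 + p * s \<noteq> 0" "1 + p * s \<in> R"
      using one_plus[OF *(2)] P_nz P_R by auto
    then show ?thesis
      using False sb * y p_nz by (auto simp: spread_def unspread_def)
  qed
  have bwd': "spread (fst (unspread (fst z) (snd z))) (snd (unspread (fst z) (snd z))) = z \<and>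
     unspread (fst z) (snd z) \<in> (R - {0}) \<times> R" if "z \<in> R \<times> R - {(0, 0)}" for z
    using that bwd[of "fst z" "snd z"] by (cases z) auto
  show "\<forall>z\<in>(R - {0}) \<times> R. (\<lambda>(x, y). unspread x y) ((\<lambda>(x, y). spread x y) z) = z"
    using fwd by (auto simp: split_beta)
  show "\<forall>z\<in>R \<times> R - {(0, 0)}. (\<lambda>(x, y). spread x y) ((\<lambda>(x, y). unspread x y) z) = z"
    using bwd' by (simp add: split_beta)
  show "(\<lambda>(x, y). spread x y) ` ((R - {0}) \<times> R) \<subseteq> R \<times> R - {(0, 0)}"
    using fwd by (auto simp: image_subset_iff)
  show "(\<lambda>(x, y). unspread x y) ` (R \<times> R - {(0, 0)}) \<subseteq> (R - {0}) \<times> R"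
    using bwd' by (simp add: split_beta image_subset_iff)
qed

text \<open>
  The composite of the two bijections on \<open>R \<times> R\<close>, extended by the identity to the whole plane.
\<close>
definition puncture :: "'a \<Rightarrow> 'a \<Rightarrow> 'a \<times> 'a" where
  "puncture x y = (if x \<in> R \<and> y \<in> R then case absorb x y of (a, b) \<Rightarrow> spread a b else (x, y))"

lemma bij_puncture: "bij_betw (\<lambda>(x, y). puncture x y) (R \<times> R) (R \<times> R - {(0, 0)})"
proof -
  have "bij_betw ((\<lambda>(x, y). spread x y) \<circ> (\<lambda>(x, y). absorb x y)) (R \<times> R) (R \<times> R - {(0, 0)})"
    using bij_absorb bij_spread by (rule bij_betw_trans)
  then show ?thesis
    by (rule iffD1[OF bij_betw_cong, rotated]) (auto simp: puncture_def)
qed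

lemma bij_puncture_UNIV: "bij_betw (\<lambda>(x, y). puncture x y) UNIV (UNIV - {(0, 0)})"
proof -
  have "bij_betw (\<lambda>(x, y). puncture x y) (- (R \<times> R)) (- (R \<times> R))"
    by (subst bij_betw_cong[where g = id]) (auto simp: puncture_def split: if_splits)
  then have "bij_betw (\<lambda>(x, y). puncture x y) (R \<times> R \<union> - (R \<times> R)) ((R \<times> R - {(0, 0)}) \<union> - (R \<times> R))"
    by (intro bij_betw_combine[OF bij_puncture]) auto
  moreover have "(R \<times> R - {(0, 0)}) \<union> - (R \<times> R) = UNIV - {(0, 0)}"
    using R_0 by auto
  ultimately show ?thesis by simp
qed

end

section \<open>Valuations\<close>

lemma with_inf_less_iff [simp]:
  "Val a < Val b \<longleftrightarrow> a < b" "Val a < Infty" "\<not> Infty < y"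
  for a b :: "'g::linorder"
  by (auto simp: less_with_inf_def not_le)

context valued_field
begin

text \<open>The valuation of a nonzero element, as an element of the value group; unspecified at 0.\<close>
definition w :: "'a \<Rightarrow> 'g" where "w x = (THE g. v x = Val g)"

lemma v_nz: "x \<noteq> 0 \<Longrightarrow> v x = Val (w x)"
  using v_eq_Infty_iff[of x] by (cases "v x") (auto simp: w_def)

lemma v_0: "v 0 = Infty"
  by (simp add: v_eq_Infty_iff)

lemma w_mult: "x \<noteq> 0 \<Longrightarrow> y \<noteq> 0 \<Longrightarrow> w (x * y) = w x + w y"
  using v_mult[of x y] by (simp add: v_nz)

lemma w_1: "w 1 = 0"
  using w_mult[of 1 1] by simp

lemma w_inverse: "x \<noteq> 0 \<Longrightarrow> w (inverse x) = - w x"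
  using w_mult[of x "inverse x"] by (simp add: w_1 eq_neg_iff_add_eq_0 add.commute)

lemma w_divide: "x \<noteq> 0 \<Longrightarrow> y \<noteq> 0 \<Longrightarrow> w (x / y) = w x - w y"
  using w_mult[of x "inverse y"] by (simp add: w_inverse divide_inverse)

lemma w_minus_1: "w (- 1) = 0"
proof -
  have "w (- 1) + w (- 1) = 0"
    using w_mult[of "-1" "-1"] by (simp add: w_1)
  then show ?thesis by simp
qed

lemma v_minus: "v (- x) = v x"
proof (cases "x = 0")
  case False
  then show ?thesis
    using w_mult[of "-1" x] by (simp add: v_nz w_minus_1)
qed simp

lemma mem_R: "0 \<le> v x \<longleftrightarrow> x = 0 \<or> 0 \<le> w x"
  by (cases "x = 0") (auto simp: v_0 v_nz zero_with_inf_def)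

lemma mem_M: "0 < v x \<longleftrightarrow> x = 0 \<or> 0 < w x"
  by (cases "x = 0") (auto simp: v_0 v_nz zero_with_inf_def)

lemma v_eq_0: "v x = 0 \<longleftrightarrow> x \<noteq> 0 \<and> w x = 0"
  by (cases "x = 0") (auto simp: v_0 v_nz zero_with_inf_def)

lemma M_add: "0 < v x \<Longrightarrow> 0 < v y \<Longrightarrow> 0 < v (x + y)"
  using v_add[of x y] by (metis less_le_trans min_less_iff_conj)

lemma R_add: "0 \<le> v x \<Longrightarrow> 0 \<le> v y \<Longrightarrow> 0 \<le> v (x + y)"
  using v_add[of x y] by (metis order_trans min.bounded_iff)

lemma max_ideal_coset:
  "max_ideal v +>\<^bsub>valuation_ring v\<^esub> x = (\<lambda>m. m + x) ` {m. 0 < v m}"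
  by (auto simp: a_r_coset_def r_coset_def valuation_ring_def ring_of_type_algebra_def max_ideal_def)

lemma max_ideal_coset_eq:
  "max_ideal v +>\<^bsub>valuation_ring v\<^esub> x = max_ideal v +>\<^bsub>valuation_ring v\<^esub> y \<longleftrightarrow> 0 < v (x - y)"
proof
  assume "max_ideal v +>\<^bsub>valuation_ring v\<^esub> x = max_ideal v +>\<^bsub>valuation_ring v\<^esub> y"
  moreover have "x \<in> (\<lambda>m. m + x) ` {m. 0 < v m}"
    by (rule image_eqI[of _ _ 0]) (auto simp: mem_M)
  ultimately show "0 < v (x - y)"
    unfolding max_ideal_coset by auto
next
  have sub: "(\<lambda>m. m + x) ` {m. 0 < v m} \<subseteq> (\<lambda>m. m + y) ` {m. 0 < v m}" if "0 < v (x - y)" for x y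
  proof (clarsimp)
    fix m assume "0 < v m"
    then show "m + x \<in> (\<lambda>m. m + y) ` {m. 0 < v m}"
      using M_add[OF _ that] by (intro image_eqI[of _ _ "m + (x - y)"]) auto
  qed
  assume "0 < v (x - y)"
  then show "max_ideal v +>\<^bsub>valuation_ring v\<^esub> x = max_ideal v +>\<^bsub>valuation_ring v\<^esub> y"
    using sub[of x y] sub[of y x] v_minus[of "x - y"] unfolding max_ideal_coset by auto
qed

lemma residue_field_one: "\<one>\<^bsub>residue_field v\<^esub> = max_ideal v +>\<^bsub>valuation_ring v\<^esub> 1"
  by (simp add: residue_field_def FactRing_def valuation_ring_def ring_of_type_algebra_def)

lemma residue_field_zero: "\<zero>\<^bsub>residue_field v\<^esub> = max_ideal v +>\<^bsub>valuation_ring v\<^esub> 0"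
  by (simp add: residue_field_def FactRing_def max_ideal_coset) (simp add: max_ideal_def)

lemma ac_mult:
  assumes "angular_component v ac" "x \<noteq> 0" "y \<noteq> 0"
  shows "ac (x * y) = ac x \<otimes>\<^bsub>residue_field v\<^esub> ac y"
  using assms unfolding angular_component_def hom_def
  by (auto simp: mult_of_def ring_of_type_algebra_def)

lemma ac_unit:
  assumes "angular_component v ac" "x \<noteq> 0"
  obtains u where "v u = 0" "ac u = ac x"
proof -
  have "ac x \<in> carrier (residue_field v)" "ac x \<noteq> \<zero>\<^bsub>residue_field v\<^esub>"
    using assms unfolding angular_component_def hom_def
    by (auto simp: mult_of_def ring_of_type_algebra_def)
  then obtain u where u: "0 \<le> v u" "ac x = max_ideal v +>\<^bsub>valuation_ring v\<^esub> u"
    by (auto simp: residue_field_def FactRing_def A_RCOSETS_def' valuation_ring_def)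
  have "\<not> 0 < v u"
    using u \<open>ac x \<noteq> _\<close> max_ideal_coset_eq[of u 0] by (simp add: residue_field_zero)
  then have "v u = 0" using u by simp
  then show ?thesis
    using that u assms(1) unfolding angular_component_def by auto
qed

text \<open>
  This is where minimality of \<open>\<gamma>\<close> is used: it makes \<open>0 < v x\<close> equivalent to \<open>x / p \<in> R\<close>.
\<close>
lemma angular_ring_R1:
  assumes ac: "angular_component v ac"
    and \<gamma>: "minimal_positive (value_group v) \<gamma>" "v \<pi> = Val \<gamma>"
  obtains p where "angular_ring (carrier (valuation_ring v)) (R1 v ac) p"
proof -
  have pi: "\<pi> \<noteq> 0" "w \<pi> = \<gamma>"
    using \<gamma>(2) v_0 v_nz[of \<pi>] by (cases "\<pi> = 0"; simp)+
  \<comment> \<open>Dividing by a unit with the same angular component makes the angular component 1.\<close>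
  obtain u where u: "v u = 0" "ac u = ac \<pi>"
    using ac_unit[OF ac pi(1)] .
  define p where "p = \<pi> * inverse u"
  have u': "u \<noteq> 0" "w u = 0" using u by (auto simp: v_eq_0)
  have p: "p \<noteq> 0" "w p = \<gamma>"
    using u' pi w_mult[of \<pi> "inverse u"] by (auto simp: p_def w_inverse)
  have pos: "0 < \<gamma>" and min: "w x > 0 \<Longrightarrow> \<gamma> \<le> w x" if "x \<noteq> 0" for x
    using \<gamma>(1) that v_nz[of x] unfolding minimal_positive_def value_group_def
    by (auto simp: not_less[symmetric])
  have ac_1: "ac 1 = \<one>\<^bsub>residue_field v\<^esub>"
    using ac unfolding angular_component_def by (simp add: v_eq_0 w_1 residue_field_one)
  have ac_p: "ac p = ac 1"
    using ac_mult[OF ac, of \<pi> "inverse u"] ac_mult[OF ac, of u "inverse u"] u u' pi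
    by (simp add: p_def)
  have ac_p_mult: "ac (p * x) = ac x" if "x \<noteq> 0" for x
    using ac_mult[OF ac p(1) that] ac_mult[OF ac _ that, of 1] ac_p by simp
  have ac_0: "ac 0 \<noteq> \<one>\<^bsub>residue_field v\<^esub>"
    using ac max_ideal_coset_eq[of 0 1]
    unfolding angular_component_def residue_field_one residue_field_zero
    by (auto simp: mem_M w_minus_1)
  have memR: "x \<in> carrier (valuation_ring v) \<longleftrightarrow> x = 0 \<or> 0 \<le> w x" for x
    by (simp add: valuation_ring_def mem_R)
  have div: "x / p \<in> carrier (valuation_ring v) \<longleftrightarrow> 0 < v x" for x
    using p min[of x] pos[of 1] by (cases "x = 0") (auto simp: memR mem_M w_divide less_le_trans)
  have mem_R1: "x \<in> R1 v ac \<longleftrightarrow> x \<noteq> 0 \<and> 0 \<le> w x \<and> ac x = ac 1" for x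
    using ac_0 by (auto simp: R1_def memR ac_1)
  have "angular_ring (carrier (valuation_ring v)) (R1 v ac) p"
  proof
    fix x y :: 'a
    show "0 \<in> carrier (valuation_ring v)" "p \<in> carrier (valuation_ring v)"
      using pos[of 1] p by (auto simp: memR w_1)
    show "p \<noteq> 0" by fact
    show "x * y \<in> carrier (valuation_ring v)"
      if "x \<in> carrier (valuation_ring v)" "y \<in> carrier (valuation_ring v)"
      using that w_mult[of x y] by (cases "x = 0 \<or> y = 0") (auto simp: memR)
    show "x \<in> carrier (valuation_ring v) \<longleftrightarrow> inverse (p * x) \<notin> carrier (valuation_ring v)"
      if "x \<noteq> 0"
    proof -
      have "inverse (p * x) = inverse x / p" by (simp add: field_simps)
      then show ?thesis
        using div[of "inverse x"] that by (auto simp: mem_M memR w_inverse not_less)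
    qed
    show "R1 v ac \<subseteq> carrier (valuation_ring v)" "0 \<notin> R1 v ac"
      by (auto simp: mem_R1 memR)
    show "p * x \<in> R1 v ac" if "x \<in> R1 v ac"
      using that p pos[of 1] by (auto simp: mem_R1 ac_p_mult w_mult)
    show "x / p \<in> R1 v ac" if "x \<in> R1 v ac" "x / p \<in> carrier (valuation_ring v)"
      using that p ac_p_mult[of "x / p"] by (auto simp: mem_R1 memR)
    have "ac x = ac 1 \<longleftrightarrow> 0 < v (x - 1)" if "v x = 0"
      using ac that max_ideal_coset_eq[of x 1] unfolding angular_component_def ac_1 residue_field_one
      by simp
    moreover have "v x = 0" if "0 < v (x - 1)"
    proof -
      have "0 \<le> v x"
        using R_add[of "x - 1" 1] that by (auto simp: mem_R[of 1] w_1)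
      moreover have "\<not> 0 < v x"
        using M_add[of x "- (x - 1)"] that v_minus[of "x - 1"] by (auto simp: mem_M[of 1] w_1)
      ultimately show ?thesis by simp
    qed
    ultimately show "x \<in> R1 v ac \<and> x / p \<notin> carrier (valuation_ring v) \<longleftrightarrow>
        (x - 1) / p \<in> carrier (valuation_ring v)"
      unfolding div by (auto simp: mem_R1 mem_M v_eq_0 not_less)
  qed
  then show ?thesis by (rule that)
qed

end

section \<open>Definable bijections in the plane\<close>

text \<open>The points of a subset of the plane, as lists of length 2.\<close>
definition planar :: "('a \<times> 'a) set \<Rightarrow> 'a list set" where
  "planar B = (\<lambda>(a, b). [a, b]) ` B"

lemma mem_planar [simp]: "[a, b] \<in> planar B \<longleftrightarrow> (a, b) \<in> B"
  by (force simp: planar_def)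

lemma tuples_2_eq_planar: "tuples 2 A = planar (A \<times> A)"
  by (force simp: tuples_def planar_def numeral_2_eq_2 length_Suc_conv)

lemma planar_minus_origin: "planar B - {[0, 0]} = planar (B - {(0, 0)})"
  by (auto simp: planar_def)

lemma append_mem_cartesian_planar:
  "xs @ [a, b] \<in> cartesian A (planar B) \<longleftrightarrow> xs \<in> A \<and> (a, b) \<in> B"
proof
  assume "xs \<in> A \<and> (a, b) \<in> B"
  then show "xs @ [a, b] \<in> cartesian A (planar B)"
    unfolding cartesian_def mem_Collect_eq by (intro exI[of _ xs] exI[of _ "[a, b]"]) simp
qed (auto simp: cartesian_def planar_def)

lemma cartesian_planarE:
  assumes "zs \<in> cartesian A (planar B)"
  obtains xs a b where "zs = xs @ [a, b]" "xs \<in> A" "(a, b) \<in> B"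
  using assms by (auto simp: cartesian_def planar_def)

lemma map_mem_cartesian_planar:
  "map x [0..<n + 2] \<in> cartesian A (planar B) \<longleftrightarrow> map x [0..<n] \<in> A \<and> (x n, x (Suc n)) \<in> B"
  using append_mem_cartesian_planar[of "map x [0..<n]"] by simp

lemma map_upt_add: "map x [0..<m + n] = map x [0..<m] @ map (\<lambda>i. x (m + i)) [0..<n]"
  by (rule nth_equalityI) (auto simp: nth_append)

context fo_definability
begin

lemma definable_subset: "definable L S n A \<Longrightarrow> A \<subseteq> tuples n UNIV"
  by (auto simp: definable_def)

lemma definable_cartesian_planar:
  assumes A: "definable L S n A" and B: "defpred (\<lambda>x. (x 0, x 1) \<in> B)"
  shows "definable L S (n + 2) (cartesian A (planar B))"
proof (rule definableI)
  show "defpred (\<lambda>x. map x [0..<n] \<in> A \<and> (x n, x (Suc n)) \<in> B)"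
    using defpred_comp2[of "\<lambda>a b. (a, b) \<in> B", OF B deffun_var deffun_var]
    by (intro defpred_conj defpred_definable[OF A])
  show "cartesian A (planar B) \<subseteq> tuples (n + 2) UNIV"
    using definable_subset[OF A] by (auto simp: cartesian_def planar_def tuples_def)
qed (simp only: map_mem_cartesian_planar)

lemma map_fibre_nonempty: "map x [0..<n + 2] = xs @ [a, b] \<longleftrightarrow>
    length xs = n \<and> (\<forall>i<n. xs ! i = x i) \<and> x n = a \<and> x (Suc n) = b"
  by (auto simp: list_eq_iff_nth_eq nth_append less_Suc_eq)

text \<open>
  The product of the identity of \<open>A\<close> with a definable bijection between subsets of the plane.
  With \<open>A\<close> the one-point set \<open>{[]}\<close> of dimension 0, this is the statement for the
  plane itself.
\<close>
lemma definably_isomorphic_cartesian_planar: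
  assumes A: "definable L S n A"
    and B: "defpred (\<lambda>x. (x 0, x 1) \<in> B)" and C: "defpred (\<lambda>x. (x 0, x 1) \<in> C)"
    and def: "deffun (\<lambda>x. fst (F (x 0) (x 1)))" "deffun (\<lambda>x. snd (F (x 0) (x 1)))"
    and bij: "bij_betw (\<lambda>(a, b). F a b) B C"
  shows "definably_isomorphic L S (cartesian A (planar B)) (cartesian A (planar C))"
proof -
  define f where "f zs = take n zs @
    [fst (F (zs ! n) (zs ! Suc n)), snd (F (zs ! n) (zs ! Suc n))]" for zs
  define G where "G = inv_into B (\<lambda>(a, b). F a b)"
  define g where "g zs = take n zs @
    [fst (G (zs ! n, zs ! Suc n)), snd (G (zs ! n, zs ! Suc n))]" for zs
  note len = definable_subset[OF A, THEN subsetD]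
  have f: "f (xs @ [a, b]) = xs @ [fst (F a b), snd (F a b)]" if "xs \<in> A" for xs a b
    using len[OF that] by (simp add: f_def tuples_def nth_append)
  have g: "g (xs @ [a, b]) = xs @ [fst (G (a, b)), snd (G (a, b))]" if "xs \<in> A" for xs a b
    using len[OF that] by (simp add: g_def tuples_def nth_append)
  have F: "F a b \<in> C" "G (F a b) = (a, b)" if "(a, b) \<in> B" for a b
    using bij_betw_inv_into_left[OF bij that] bij_betwE[OF bij] that by (auto simp: G_def)
  have G: "G c \<in> B" "F (fst (G c)) (snd (G c)) = c" if "c \<in> C" for c
    using bij_betw_inv_into_right[OF bij that] bij_betwE[OF bij_betw_inv_into[OF bij]] that
    by (auto simp: G_def split_beta)
  have "bij_betw f (cartesian A (planar B)) (cartesian A (planar C))"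
  proof (rule bij_betw_byWitness[where f' = g])
    show "\<forall>z\<in>cartesian A (planar B). g (f z) = z"
      by (auto elim!: cartesian_planarE simp: f g F)
    show "\<forall>z\<in>cartesian A (planar C). f (g z) = z"
      by (auto elim!: cartesian_planarE simp: f g G)
    show "f ` cartesian A (planar B) \<subseteq> cartesian A (planar C)"
      by (auto elim!: cartesian_planarE simp: f F append_mem_cartesian_planar)
    show "g ` cartesian A (planar C) \<subseteq> cartesian A (planar B)"
      by (auto elim!: cartesian_planarE simp: g G append_mem_cartesian_planar)
  qed
  moreover have "definable L S ((n + 2) + (n + 2)) {zs @ f zs | zs. zs \<in> cartesian A (planar B)}"
  proof (rule definableI)
    let ?P = "\<lambda>x. (map x [0..<n] \<in> A \<and> (x n, x (Suc n)) \<in> B) \<and> (\<forall>i<n. x (n + 2 + i) = x i) \<and>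
      x (n + 2 + n) = fst (F (x n) (x (Suc n))) \<and> x (n + 2 + Suc n) = snd (F (x n) (x (Suc n)))"
    show "defpred ?P"
      using defpred_comp2[of "\<lambda>a b. (a, b) \<in> B", OF B deffun_var deffun_var]
        deffun_comp2[of "\<lambda>a b. fst (F a b)", OF def(1) deffun_var deffun_var]
        deffun_comp2[of "\<lambda>a b. snd (F a b)", OF def(2) deffun_var deffun_var]
      by (intro defpred_conj defpred_definable[OF A] defpred_all_less defpred_eq deffun_var)
    show "{zs @ f zs | zs. zs \<in> cartesian A (planar B)} \<subseteq> tuples ((n + 2) + (n + 2)) UNIV"
      using len by (auto simp: cartesian_def planar_def tuples_def f)
    fix x :: "nat \<Rightarrow> 'a"
    define us where "us = map x [0..<n + 2]"
    define vs where "vs = map (\<lambda>i. x (n + 2 + i)) [0..<n + 2]"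
    have split: "map x [0..<(n + 2) + (n + 2)] = us @ vs"
      unfolding us_def vs_def by (rule map_upt_add)
    have "length zs = n + 2" if "zs \<in> cartesian A (planar B)" for zs
      using len that by (auto simp: cartesian_def planar_def tuples_def)
    moreover have "length us = n + 2"
      by (simp add: us_def)
    ultimately have "us @ vs \<in> {zs @ f zs | zs. zs \<in> cartesian A (planar B)} \<longleftrightarrow>
        us \<in> cartesian A (planar B) \<and> vs = f us"
      by (auto simp: append_eq_append_conv)
    also have "us \<in> cartesian A (planar B) \<longleftrightarrow> map x [0..<n] \<in> A \<and> (x n, x (Suc n)) \<in> B"
      unfolding us_def by (rule map_mem_cartesian_planar)
    also have "f us = map x [0..<n] @ [fst (F (x n) (x (Suc n))), snd (F (x n) (x (Suc n)))]"
      by (simp add: us_def f_def nth_append)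
    also have "vs = \<dots> \<longleftrightarrow> (\<forall>i<n. x (n + 2 + i) = x i) \<and>
      x (n + 2 + n) = fst (F (x n) (x (Suc n))) \<and> x (n + 2 + Suc n) = snd (F (x n) (x (Suc n)))"
      unfolding vs_def map_fibre_nonempty by auto
    finally show "?P x \<longleftrightarrow> map x [0..<(n + 2) + (n + 2)] \<in> {zs @ f zs | zs. zs \<in> cartesian A (planar B)}"
      unfolding split by blast
  qed
  ultimately show ?thesis
    unfolding definably_isomorphic_def
    using definable_cartesian_planar[OF A B] definable_cartesian_planar[OF A C]
    by (intro exI[of _ "n + 2"] exI[of _ f] conjI) (assumption | simp)+
qed

lemma definably_isomorphic_times_point:
  assumes A: "definable L S n A" "n > 0"
  shows "definably_isomorphic L S A (cartesian A (planar {(c, d)}))"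
proof -
  define f where "f xs = xs @ [c, d]" for xs
  note len = definable_subset[OF A(1), THEN subsetD]
  have pt: "defpred (\<lambda>x. (x 0, x 1) \<in> {(c, d)})"
    using defpred_conj[OF defpred_eq[OF deffun_var deffun_const] defpred_eq[OF deffun_var deffun_const],
        of 0 c 1 d] by simp
  have "bij_betw f A (cartesian A (planar {(c, d)}))"
    by (auto simp: bij_betw_def inj_on_def f_def cartesian_def planar_def)
  moreover have "definable L S (n + (n + 2)) {xs @ f xs | xs. xs \<in> A}"
  proof (rule definableI)
    let ?P = "\<lambda>x. map x [0..<n] \<in> A \<and> (\<forall>i<n. x (n + i) = x i) \<and> x (n + n) = c \<and> x (n + Suc n) = d"
    show "defpred ?P"
      by (intro defpred_conj defpred_definable[OF A(1)] defpred_all_less defpred_eq deffun_var deffun_const)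
    show "{xs @ f xs | xs. xs \<in> A} \<subseteq> tuples (n + (n + 2)) UNIV"
      using len by (auto simp: tuples_def f_def)
    fix x :: "nat \<Rightarrow> 'a"
    define vs where "vs = map (\<lambda>i. x (n + i)) [0..<n + 2]"
    have split: "map x [0..<n + (n + 2)] = map x [0..<n] @ vs"
      unfolding vs_def by (rule map_upt_add)
    have "map x [0..<n] @ vs \<in> {xs @ f xs | xs. xs \<in> A} \<longleftrightarrow>
        map x [0..<n] \<in> A \<and> vs = map x [0..<n] @ [c, d]"
      using len by (auto simp: f_def tuples_def append_eq_append_conv)
    also have "vs = map x [0..<n] @ [c, d] \<longleftrightarrow>
        (\<forall>i<n. x (n + i) = x i) \<and> x (n + n) = c \<and> x (n + Suc n) = d"
      unfolding vs_def map_fibre_nonempty by auto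
    finally show "?P x \<longleftrightarrow> map x [0..<n + (n + 2)] \<in> {xs @ f xs | xs. xs \<in> A}"
      unfolding split by simp
  qed
  ultimately show ?thesis
    unfolding definably_isomorphic_def using A definable_cartesian_planar[OF A(1) pt] by blast
qed

end

section \<open>The Grothendieck ring\<close>

lemma definable_free_add_group:
  "comm_group (add_monoid (definable_free L S))"
proof (rule comm_groupI)
  fix x assume "x \<in> carrier (add_monoid (definable_free L S))"
  then show "\<exists>y\<in>carrier (add_monoid (definable_free L S)).
      y \<otimes>\<^bsub>add_monoid (definable_free L S)\<^esub> x = \<one>\<^bsub>add_monoid (definable_free L S)\<^esub>"
    by (intro bexI[of _ "- x"]) (auto simp: definable_free_def)
qed (auto simp: definable_free_def add_ac dest: subsetD[OF keys_add])

lemma definable_free_inv: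
  assumes "x \<in> carrier (definable_free L S)"
  shows "inv\<^bsub>add_monoid (definable_free L S)\<^esub> x = - x"
proof -
  interpret comm_group "add_monoid (definable_free L S)" by (rule definable_free_add_group)
  show ?thesis
    using assms by (intro inv_equality) (auto simp: definable_free_def)
qed

lemma K0_relations_carrier: "K0_relations L S \<subseteq> carrier (definable_free L S)"
proof -
  have "A \<in> definable_sets L S \<and> A' \<in> definable_sets L S" if "definably_isomorphic L S A A'" for A A'
    using that by (auto simp: definably_isomorphic_def definable_sets_def)
  then show ?thesis
    using keys_diff keys_add
    by (fastforce simp: K0_relations_def definable_free_def)
qed

text \<open>
  The Grothendieck ring is trivial as soon as the relations generate the class of every
  definable set.
\<close>
lemma K0_trivialI:
  assumes "\<And>A. A \<in> definable_sets L S \<Longrightarrow>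
    frag_of A \<in> generate (add_monoid (definable_free L S)) (K0_relations L S)"
  shows "carrier (K0 L S) = {\<zero>\<^bsub>K0 L S\<^esub>}"
proof -
  let ?G = "add_monoid (definable_free L S)"
  let ?I = "generate ?G (K0_relations L S)"
  interpret comm_group ?G by (rule definable_free_add_group)
  have sub: "subgroup ?I ?G"
    by (rule generate_is_subgroup) (simp add: K0_relations_carrier)
  have neg: "- x \<in> ?I" if "x \<in> ?I" for x
    using subgroup.m_inv_closed[OF sub that] subgroup.mem_carrier[OF sub that]
      definable_free_inv[of x L S] by simp
  have "x \<in> ?I" if "x \<in> carrier (definable_free L S)" for x
  proof -
    have "Poly_Mapping.keys x \<subseteq> definable_sets L S"
      using that by (simp add: definable_free_def)
    then show ?thesis
    proof (induction x rule: frag_induction)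
      case zero
      then show ?case using generate.one[of ?G] by (simp add: definable_free_def)
    next
      case (one A)
      then show ?case by (rule assms)
    next
      case (diff a b)
      then show ?case
        using generate.eng[OF diff(1) neg[OF diff(2)]] by (simp add: definable_free_def)
    qed
  qed
  then have all: "?I = carrier (definable_free L S)"
    using subgroup.subset[OF sub] by auto
  have "?I +>\<^bsub>definable_free L S\<^esub> x = ?I" if "x \<in> carrier (definable_free L S)" for x
    using coset_join2[OF _ sub, of x] that all by (simp add: a_r_coset_def)
  moreover have "\<zero>\<^bsub>definable_free L S\<^esub> \<in> carrier (definable_free L S)"
    by (simp add: definable_free_def)
  ultimately show ?thesis
    by (auto simp: K0_def FactRing_def A_RCOSETS_def')
qed

text \<open>
  If a definable subset of the plane stays isomorphic to itself, in all products, when one of its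
  points is removed, then every class \<open>[A] = [A \<times> {(c, d)}]\<close> is 0.
\<close>
lemma K0_trivial:
  fixes L :: "('f, 'r) language" and S :: "('f, 'r, 'a::zero) fo_struct"
  assumes iso: "\<And>n A. definable L S n A \<Longrightarrow>
      definably_isomorphic L S (cartesian A (planar B)) (cartesian A (planar (B - {(c, d)})))"
    and B: "fo_definability.defpred L S (\<lambda>x. (x 0, x 1) \<in> B)" "(c, d) \<in> B"
  shows "carrier (K0 L S) = {\<zero>\<^bsub>K0 L S\<^esub>}"
proof (rule K0_trivialI)
  interpret fo_definability L S .
  let ?D = "definable_free L S" and ?G = "add_monoid (definable_free L S)"
  let ?I = "generate ?G (K0_relations L S)"
  fix A assume "A \<in> definable_sets L S"
  then obtain n where A: "n > 0" "definable L S n A"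
    by (auto simp: definable_sets_def)
  have plus: "x + y \<in> ?I" if "x \<in> ?I" "y \<in> ?I" for x y
    using generate.eng[OF that] by (simp add: definable_free_def)
  have minus: "- x \<in> ?I" if "x \<in> K0_relations L S" for x
    using generate.inv[OF that, of ?G] definable_free_inv[of x L S] that K0_relations_carrier[of L S]
    by auto
  define AB where "AB = cartesian A (planar B)"
  define AB' where "AB' = cartesian A (planar (B - {(c, d)}))"
  define AO where "AO = cartesian A (planar {(c, d)})"
  have "frag_of A - frag_of AO \<in> ?I" "frag_of AB - frag_of AB' \<in> K0_relations L S"
    using definably_isomorphic_times_point[OF A(2,1), of c d] iso[OF A(2)]
    unfolding AB_def AB'_def AO_def K0_relations_def by (auto intro!: generate.incl)
  moreover have "frag_of AB - (frag_of AB' + frag_of AO) \<in> K0_relations L S"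
  proof -
    have "AB \<in> definable_sets L S" "AB' \<in> definable_sets L S" "AO \<in> definable_sets L S"
      using iso[OF A(2)] definably_isomorphic_times_point[OF A(2,1), of c d]
      unfolding AB_def AB'_def AO_def definable_sets_def definably_isomorphic_def by auto
    moreover have "AB = AB' \<union> AO" "AB' \<inter> AO = {}"
      using B(2) unfolding AB_def AB'_def AO_def
      by (auto simp: append_mem_cartesian_planar elim!: cartesian_planarE)
    ultimately show ?thesis
      unfolding K0_relations_def by blast
  qed
  moreover have "frag_of A = (frag_of A - frag_of AO) +
      ((frag_of AB - frag_of AB') + - (frag_of AB - (frag_of AB' + frag_of AO)))"
    by (simp add: algebra_simps)
  ultimately show "frag_of A \<in> ?I"
    by (metis plus minus generate.incl)
qed

section \<open>Definability of the puncturing map\<close>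

lemma defpred_Lv:
  fixes v :: "'a::field \<Rightarrow> 'g::linordered_ab_group_add with_inf"
    and L :: "('f vf_fun, 'r vf_rel) language"
    and S :: "('f vf_fun, 'r vf_rel, 'a) fo_struct"
  assumes "is_expansion L S Lv (Lv_struct v)"
  shows "fo_definability.defpred L S (\<lambda>x. x 0 = x 1 + x 2)" "fo_definability.defpred L S (\<lambda>x. x 0 = x 1 - x 2)"
    "fo_definability.defpred L S (\<lambda>x. x 0 = x 1 * x 2)" "fo_definability.defpred L S (\<lambda>x. x 0 \<in> carrier (valuation_ring v))"
proof -
  interpret fo_definability L S .
  have ops: "f \<in> funs L" "farity L f = 2" "finterp S f [a, b] = Lv_fun f [a, b]"
    if "f \<in> {Plus, Minus, Times}" for f a b
    using assms(1) that by (auto simp: is_expansion_def Lv_def Lv_struct_def)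
  have rel: "InR \<in> rels L" "rarity L InR = 1" "rinterp S InR [a] = Lv_rel v InR [a]" for a
    using assms(1) by (auto simp: is_expansion_def Lv_def Lv_struct_def)
  have "defpred (\<lambda>x. x 0 = Lv_fun f [x 1, x 2])" if "f \<in> {Plus, Minus, Times}" for f :: "'f vf_fun"
    by (rule defpredI[of "Eq (Var 0) (App f [Var 2, Var 4])" id])
      (use ops[OF that] in \<open>auto simp: interleave_def\<close>)
  from this[of Plus] this[of Minus] this[of Times]
  show "defpred (\<lambda>x. x 0 = x 1 + x 2)" "defpred (\<lambda>x. x 0 = x 1 - x 2)"
    "defpred (\<lambda>x. x 0 = x 1 * x 2)"
    by simp_all
  show "defpred (\<lambda>x. x 0 \<in> carrier (valuation_ring v))"
    by (rule defpredI[of "Rel InR [Var 0]" id]) (use rel in \<open>auto simp: interleave_def\<close>)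
qed

text \<open>The algebraic data above, definable in a structure in which the field operations are definable.\<close>
locale definable_angular_ring = angular_ring R P p + fo_definability L S
  for R P :: "'a::field set" and p :: 'a
    and L :: "('f, 'r) language" and S :: "('f, 'r, 'a) fo_struct" +
  assumes defpred_plus: "defpred (\<lambda>x. x 0 = x 1 + x 2)"
    and defpred_minus: "defpred (\<lambda>x. x 0 = x 1 - x 2)"
    and defpred_times: "defpred (\<lambda>x. x 0 = x 1 * x 2)"
    and defpred_R: "defpred (\<lambda>x. x 0 \<in> R)"
    and defpred_P: "defpred (\<lambda>x. x 0 \<in> P)"
begin

lemma deffun_plus: "deffun t \<Longrightarrow> deffun s \<Longrightarrow> deffun (\<lambda>x. t x + s x)"
  by (rule deffun_comp2[of "(+)"]) (use defpred_plus in \<open>simp_all add: deffun_def numeral_2_eq_2\<close>)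

lemma deffun_minus: "deffun t \<Longrightarrow> deffun s \<Longrightarrow> deffun (\<lambda>x. t x - s x)"
  by (rule deffun_comp2[of "(-)"]) (use defpred_minus in \<open>simp_all add: deffun_def numeral_2_eq_2\<close>)

lemma deffun_times: "deffun t \<Longrightarrow> deffun s \<Longrightarrow> deffun (\<lambda>x. t x * s x)"
  by (rule deffun_comp2[of "(*)"]) (use defpred_times in \<open>simp_all add: deffun_def numeral_2_eq_2\<close>)

lemma deffun_divide_p: "deffun t \<Longrightarrow> deffun (\<lambda>x. t x / p)"
  using deffun_times[OF _ deffun_const[of "inverse p"]] by (simp add: divide_inverse)

lemmas def_intros = defpred_conj defpred_eq deffun_if deffun_plus deffun_minus deffun_times
  deffun_divide_p deffun_const deffun_var
  defpred_comp1[of "\<lambda>a. a \<in> R", OF defpred_R] defpred_comp1[of "\<lambda>a. a \<in> P", OF defpred_P]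

lemma fst_absorb: "fst (absorb x y) = (if x = 0 then 1 + p * y else if y = 0 \<and> x \<in> P then p * x else x)"
  and snd_absorb: "snd (absorb x y) = (if x = 0 then 0 else if y = 0 \<and> x \<in> P then 0 else y)"
  by (auto simp: absorb_def)

lemma deffun_absorb:
  assumes "deffun t" "deffun s"
  shows "deffun (\<lambda>x. fst (absorb (t x) (s x)))" "deffun (\<lambda>x. snd (absorb (t x) (s x)))"
  unfolding fst_absorb snd_absorb by (intro def_intros assms)+

lemma fst_spread: "fst (spread a b) =
    (if (a - 1) / p \<in> R then p * fst (absorb ((a - 1) / p) b) * snd (absorb ((a - 1) / p) b)
     else if a \<in> P then a / p else a)"
  and snd_spread: "snd (spread a b) =
    (if (a - 1) / p \<in> R then fst (absorb ((a - 1) / p) b) else if a \<in> P then a / p * b else a * b)"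
  by (auto simp: spread_def split_beta)

lemma deffun_spread:
  assumes "deffun t" "deffun s"
  shows "deffun (\<lambda>x. fst (spread (t x) (s x)))" "deffun (\<lambda>x. snd (spread (t x) (s x)))"
  unfolding fst_spread snd_spread by (intro def_intros deffun_absorb assms)+

lemma fst_puncture: "fst (puncture x y) =
    (if x \<in> R \<and> y \<in> R then fst (spread (fst (absorb x y)) (snd (absorb x y))) else x)"
  and snd_puncture: "snd (puncture x y) =
    (if x \<in> R \<and> y \<in> R then snd (spread (fst (absorb x y)) (snd (absorb x y))) else y)"
  by (auto simp: puncture_def split_beta)

lemma deffun_puncture:
  "deffun (\<lambda>x. fst (puncture (x 0) (x 1)))" "deffun (\<lambda>x. snd (puncture (x 0) (x 1)))"
  unfolding fst_puncture snd_puncture by (intro def_intros deffun_spread deffun_absorb)+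

lemma defpred_minus_origin:
  assumes "defpred (\<lambda>x. (x 0, x 1) \<in> B)"
  shows "defpred (\<lambda>x. (x 0, x 1) \<in> B - {(0, 0)})"
  using defpred_conj[OF assms defpred_neg[OF defpred_conj[OF
      defpred_eq[OF deffun_var[of 0] deffun_const[of 0]]
      defpred_eq[OF deffun_var[of 1] deffun_const[of 0]]]]] by simp

lemma defpred_R2: "defpred (\<lambda>x. (x 0, x 1) \<in> R \<times> R)"
  unfolding mem_Sigma_iff by (intro def_intros)

lemma defpred_K2: "defpred (\<lambda>x. (x 0, x 1) \<in> UNIV)"
  using defpred_eq[OF deffun_var[of 0] deffun_var[of 0]] by simp

lemma puncture_iso:
  assumes "definable L S n A"
    and "defpred (\<lambda>x. (x 0, x 1) \<in> B)" "bij_betw (\<lambda>(x, y). puncture x y) B (B - {(0, 0)})"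
  shows "definably_isomorphic L S (cartesian A (planar B)) (cartesian A (planar (B - {(0, 0)})))"
  by (rule definably_isomorphic_cartesian_planar[OF assms(1,2) defpred_minus_origin[OF assms(2)]
        deffun_puncture assms(3)])

text \<open>The case of a single point in dimension 0.\<close>
lemma puncture_iso_plane:
  assumes "defpred (\<lambda>x. (x 0, x 1) \<in> B)" "bij_betw (\<lambda>(x, y). puncture x y) B (B - {(0, 0)})"
  shows "definably_isomorphic L S (planar B) (planar B - {[0, 0]})"
proof -
  have "definable L S 0 {[]}"
    by (rule definableI[OF defpred_K2]) (auto simp: tuples_def)
  from puncture_iso[OF this assms] show ?thesis
    by (simp add: cartesian_def planar_minus_origin)
qed

end

theorem proposition2:
  fixes v :: "'a::field \<Rightarrow> 'g::linordered_ab_group_add with_inf"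
    and \<pi> :: 'a
    and ac :: "'a \<Rightarrow> 'a set"
    and L :: "('f vf_fun, 'r vf_rel) language"
    and S :: "('f vf_fun, 'r vf_rel, 'a) fo_struct"
  defines "R \<equiv> carrier (valuation_ring v)"
  assumes "valued_field v"
    and "\<exists>!\<gamma>. minimal_positive (value_group v) \<gamma>"
    and "\<pi> \<in> R" and "\<exists>\<gamma>. minimal_positive (value_group v) \<gamma> \<and> v \<pi> = Val \<gamma>"
    and "is_expansion L S Lv (Lv_struct v)"
    and "angular_component v ac"
    and "definable L S 1 (tuples 1 (R1 v ac))"
  shows "carrier (K0 L S) = {\<zero>\<^bsub>K0 L S\<^esub>}
    \<and> definably_isomorphic L S (tuples 2 UNIV) (tuples 2 UNIV - {[0, 0]})
    \<and> definably_isomorphic L S (tuples 2 R) (tuples 2 R - {[0, 0]})"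
proof -
  interpret valued_field v by fact
  obtain \<gamma> where "minimal_positive (value_group v) \<gamma>" "v \<pi> = Val \<gamma>"
    using assms by blast
  then obtain p where "angular_ring R (R1 v ac) p"
    using angular_ring_R1[OF \<open>angular_component v ac\<close>] unfolding R_def by blast
  moreover have "fo_definability.defpred L S (\<lambda>x. x 0 \<in> R1 v ac)"
    using fo_definability.defpred_definable[OF \<open>definable L S 1 (tuples 1 (R1 v ac))\<close>]
    by (simp add: tuples_def)
  ultimately interpret definable_angular_ring R "R1 v ac" p L S
    using defpred_Lv[OF \<open>is_expansion L S Lv (Lv_struct v)\<close>]
    unfolding definable_angular_ring_def definable_angular_ring_axioms_def R_def by simp
  have "carrier (K0 L S) = {\<zero>\<^bsub>K0 L S\<^esub>}"
    by (rule K0_trivial[OF puncture_iso[OF _ defpred_K2 bij_puncture_UNIV] defpred_K2]) simp_all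
  then show ?thesis
    using puncture_iso_plane[OF defpred_K2 bij_puncture_UNIV]
      puncture_iso_plane[OF defpred_R2 bij_puncture]
    by (simp add: tuples_2_eq_planar)
qed

end
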